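(* Let $\alpha>0$, $\alpha\neq1$, let $\mathbf{X}_1,\dots,\mathbf{X}_n$ be a sample, and let $\{p_\theta:\theta\in\Theta\}$ be a family characterized by $h,w,f,\Theta,\mathbb{S}$. (a) If the family is a regular $\mathbb{B}^{(\alpha)}$-family, then the system $\partial_r[w(\theta)]^\top\mathbb{E}_\theta[f(\mathbf{X})]=\partial_r[w(\theta)]^\top\bar f$, $r\in\{1,\dots,k\}$, reduces to $$\mathbb{E}_\theta[f(\mathbf{X})]=\bar f.$$ (b) If the family is a regular $\mathbb{M}^{(\alpha)}$-family, then the system $\dfrac{\partial_r[w(\theta)]^\top\mathbb{E}_\theta[f(\mathbf{X})]}{\mathbb{E}_\theta[h(\mathbf{X})+w(\theta)^\top f(\mathbf{X})]}=\dfrac{\partial_r[w(\theta)]^\top\bar f}{\bar h+w(\theta)^\top\bar f}$, $r\in\{1,\dots,k\}$, reduces to $$\frac{\mathbb{E}_\theta[f(\mathbf{X})]}{\mathbb{E}_\theta[h(\mathbf{X})]}=\frac{\bar f}{\bar h}.$$ (c) If the family is a regular $\mathscr{E}^{(\alpha)}$-family, then the system $\dfrac{\partial_r[w(\theta)]^\top\mathbb{E}_{\theta^{(\alpha)}}[f(\mathbf{X})]}{\mathbb{E}_{\theta^{(\alpha)}}[h(\mathbf{X})+w(\theta)^\top f(\mathbf{X})]}=\dfrac{\partial_r[w(\theta)]^\top\overline f^{(\alpha)}}{\overline h^{(\alpha)}+w(\theta)^\top\overline f^{(\alpha)}}$, $r\in\{1,\dots,k\}$, reduces to $$\frac{\mathbb{E}_{\theta^{(\alpha)}}[f(\mathbf{X})]}{\mathbb{E}_{\theta^{(\alpha)}}[h(\mathbf{X})]}=\frac{\overline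 f^{(\alpha)}}{\overline h^{(\alpha)}}.$$
   Context: Integrals are over $\mathbb{S}\subseteq\mathbb{R}^d$ with respect to Lebesgue measure (continuous case) or counting measure (discrete case); all integrals and quotients involved are assumed well defined. Families: let $\Theta\subset\mathbb{R}^k$ be open, $w=[w_1,\dots,w_s]^\top$ with $w_i:\Theta\to\mathbb{R}$ differentiable, $f=[f_1,\dots,f_s]^\top$, $f_i:\mathbb{R}^d\to\mathbb{R}$, $h:\mathbb{R}^d\to\mathbb{R}$. For $\mathbf{x}\in\mathbb{S}$ (and $p_\theta=0$ off $\mathbb{S}$): - $\mathbb{B}^{(\alpha)}$: $p_\theta(\mathbf{x})=[h(\mathbf{x})+F(\theta)+w(\theta)^\top f(\mathbf{x})]^{1/(\alpha-1)}$; - $\mathbb{M}^{(\alpha)}$: $p_\theta(\mathbf{x})=Z(\theta)[h(\mathbf{x})+w(\theta)^\top f(\mathbf{x})]^{1/(\alpha-1)}$; - $\mathscr{E}^{(\alpha)}$: $p_\theta(\mathbf{x})=Z(\theta)[h(\mathbf{x})+w(\theta)^\top f(\mathbf{x})]^{1/(1-\alpha)}$, with $F,Z:\Theta\to\mathbb{R}$ differentiable normalizing functions. Each is regular if (i) $\mathbb{S}$ does not depend on $\theta$, (ii) $s=k$, (iii) $1,w_1,\dots,w_s$ are linearly independent on $\Theta$, and (iv) $1,f_1,\dots,f_s$ (for $\mathbb{B}^{(\alpha)}$), respectively $f_1,\dots,f_s$ (for $\mathbb{M}^{(\alpha)}$ and $\mathscr{E}^{(\alpha)}$), are linearly independent on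 $\mathbb{S}$. Notation: $\partial_r[w(\theta)]=[\partial w_1/\partial\theta_r,\dots,\partial w_s/\partial\theta_r]^\top$; $\mathbb{E}_\theta$ is expectation under $p_\theta$; $\bar f=\frac1n\sum_j f(\mathbf{X}_j)$, $\bar h=\frac1n\sum_j h(\mathbf{X}_j)$; for a density $p$, $p^{(\alpha)}=p^\alpha/\int p^\alpha$; $\mathbb{E}_{\theta^{(\alpha)}}$ is expectation under $p_\theta^{(\alpha)}$; $\overline h^{(\alpha)},\overline f^{(\alpha)}$ are the expectations of $h,f$ under $\widetilde p_n^{(\alpha)}$, where $\widetilde p_n$ is the empirical distribution of the sample in the discrete case and a continuous (density) estimate of it in the continuous case. The displayed systems are the estimating equations for $\theta\in\Theta$ of Basu et al. (a), Jones et al. (b) and generalized Hellinger (c) estimation on these families; "reduces to" means equivalence as equations in $\theta$.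
   Formalization: The implication from each system to its reduced equation is proved only at those θ where the Jacobian matrix of w is invertible, which linear independence of 1, w_1, …, w_s does not ensure (w=θ³ at θ=0 is a counterexample); the converse implication needs no such condition. *)

theory Defs
  imports "HOL-Analysis.Analysis"
begin

datatype kind = Discrete | Continuous

definition base_measure :: "kind \<Rightarrow> (real^'d) set \<Rightarrow> (real^'d) measure" where
  "base_measure K S = (case K of Discrete \<Rightarrow> count_space S | Continuous \<Rightarrow> lebesgue_on S)"

definition admissible_space :: "kind \<Rightarrow> (real^'d) set \<Rightarrow> bool" where
  "admissible_space K S \<longleftrightarrow> (K = Continuous \<longrightarrow> S \<in> sets lebesgue)"

definition prob_density :: "'x measure \<Rightarrow> ('x \<Rightarrow> real) \<Rightarrow> bool" where
  "prob_density M q \<longleftrightarrow>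
     (\<forall>x\<in>space M. 0 \<le> q x) \<and> integrable M q \<and> integral\<^sup>L M q = 1"

definition has_expectation ::
    "'x measure \<Rightarrow> ('x \<Rightarrow> real) \<Rightarrow> ('x \<Rightarrow> 'b::euclidean_space) \<Rightarrow> bool" where
  "has_expectation M q g \<longleftrightarrow> integrable M (\<lambda>x. q x *\<^sub>R g x)"

definition expect ::
    "'x measure \<Rightarrow> ('x \<Rightarrow> real) \<Rightarrow> ('x \<Rightarrow> 'b::euclidean_space) \<Rightarrow> 'b" where
  "expect M q g = (\<integral>x. q x *\<^sub>R g x \<partial>M)"

definition has_escort :: "'x measure \<Rightarrow> real \<Rightarrow> ('x \<Rightarrow> real) \<Rightarrow> bool" where
  "has_escort M \<alpha> q \<longleftrightarrow>
     integrable M (\<lambda>x. q x powr \<alpha>) \<and> (\<integral>x. q x powr \<alpha> \<partial>M) \<noteq> 0"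

definition escort :: "'x measure \<Rightarrow> real \<Rightarrow> ('x \<Rightarrow> real) \<Rightarrow> 'x \<Rightarrow> real" where
  "escort M \<alpha> q = (\<lambda>x. q x powr \<alpha> / (\<integral>y. q y powr \<alpha> \<partial>M))"

definition sample_mean :: "nat \<Rightarrow> (nat \<Rightarrow> 'x) \<Rightarrow> ('x \<Rightarrow> 'b::real_vector) \<Rightarrow> 'b" where
  "sample_mean n X g = (1 / real n) *\<^sub>R (\<Sum>j\<in>{1..n}. g (X j))"

definition empirical :: "nat \<Rightarrow> (nat \<Rightarrow> 'x) \<Rightarrow> 'x \<Rightarrow> real" where
  "empirical n X x = real (card {j\<in>{1..n}. X j = x}) / real n"

text \<open>
  In the continuous case the density estimate built from the sample may be any probability
  density: no particular smoothing procedure is singled out.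
\<close>

definition sample_estimate ::
    "kind \<Rightarrow> (real^'d) set \<Rightarrow> nat \<Rightarrow> (nat \<Rightarrow> real^'d) \<Rightarrow> (real^'d \<Rightarrow> real) \<Rightarrow> bool" where
  "sample_estimate K S n X q \<longleftrightarrow>
     (case K of Discrete \<Rightarrow> q = empirical n X
              | Continuous \<Rightarrow> prob_density (base_measure Continuous S) q)"

definition lin_indep_on :: "'x set \<Rightarrow> ('x \<Rightarrow> real^'s) \<Rightarrow> bool" where
  "lin_indep_on A g \<longleftrightarrow> (\<forall>c. (\<forall>x\<in>A. c \<bullet> g x = 0) \<longrightarrow> c = 0)"

text \<open>Linear independence of the constant function \<open>1\<close> together with the components of \<open>g\<close>.\<close>

definition lin_indep_with_1_on :: "'x set \<Rightarrow> ('x \<Rightarrow> real^'s) \<Rightarrow> bool" where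
  "lin_indep_with_1_on A g \<longleftrightarrow>
     (\<forall>c0 c. (\<forall>x\<in>A. c0 + c \<bullet> g x = 0) \<longrightarrow> c0 = 0 \<and> c = 0)"

text \<open>The real power \<open>b powr e\<close> is only meant for nonnegative \<open>b\<close>, and for \<open>b = 0\<close> only if \<open>e > 0\<close>.\<close>

definition power_defined :: "real \<Rightarrow> real \<Rightarrow> bool" where
  "power_defined b e \<longleftrightarrow> 0 < b \<or> b = 0 \<and> 0 < e"

definition parametric_densities ::
    "kind \<Rightarrow> (real^'d) set \<Rightarrow> (real^'k) set \<Rightarrow> (real^'k \<Rightarrow> real^'s)
      \<Rightarrow> (real^'k \<Rightarrow> real^'d \<Rightarrow> real) \<Rightarrow> bool" where
  "parametric_densities K S \<Theta> w p \<longleftrightarrow>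
     admissible_space K S \<and> open \<Theta> \<and> (\<forall>\<theta>\<in>\<Theta>. w differentiable (at \<theta>)) \<and>
     (\<forall>\<theta>\<in>\<Theta>. prob_density (base_measure K S) (p \<theta>) \<and> (\<forall>x. x \<notin> S \<longrightarrow> p \<theta> x = 0))"

definition B_family ::
    "kind \<Rightarrow> (real^'d) set \<Rightarrow> (real^'k) set \<Rightarrow> real \<Rightarrow> (real^'d \<Rightarrow> real) \<Rightarrow> (real^'d \<Rightarrow> real^'s)
      \<Rightarrow> (real^'k \<Rightarrow> real^'s) \<Rightarrow> (real^'k \<Rightarrow> real^'d \<Rightarrow> real) \<Rightarrow> bool" where
  "B_family K S \<Theta> \<alpha> h f w p \<longleftrightarrow> parametric_densities K S \<Theta> w p \<and>
     (\<exists>F :: real^'k \<Rightarrow> real. (\<forall>\<theta>\<in>\<Theta>. F differentiable (at \<theta>)) \<and>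
       (\<forall>\<theta>\<in>\<Theta>. \<forall>x\<in>S. power_defined (h x + F \<theta> + w \<theta> \<bullet> f x) (1 / (\<alpha> - 1)) \<and>
          p \<theta> x = (h x + F \<theta> + w \<theta> \<bullet> f x) powr (1 / (\<alpha> - 1))))"

definition M_family ::
    "kind \<Rightarrow> (real^'d) set \<Rightarrow> (real^'k) set \<Rightarrow> real \<Rightarrow> (real^'d \<Rightarrow> real) \<Rightarrow> (real^'d \<Rightarrow> real^'s)
      \<Rightarrow> (real^'k \<Rightarrow> real^'s) \<Rightarrow> (real^'k \<Rightarrow> real^'d \<Rightarrow> real) \<Rightarrow> bool" where
  "M_family K S \<Theta> \<alpha> h f w p \<longleftrightarrow> parametric_densities K S \<Theta> w p \<and>
     (\<exists>Z :: real^'k \<Rightarrow> real. (\<forall>\<theta>\<in>\<Theta>. Z differentiable (at \<theta>)) \<and>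
       (\<forall>\<theta>\<in>\<Theta>. \<forall>x\<in>S. power_defined (h x + w \<theta> \<bullet> f x) (1 / (\<alpha> - 1)) \<and>
          p \<theta> x = Z \<theta> * (h x + w \<theta> \<bullet> f x) powr (1 / (\<alpha> - 1))))"

definition E_family ::
    "kind \<Rightarrow> (real^'d) set \<Rightarrow> (real^'k) set \<Rightarrow> real \<Rightarrow> (real^'d \<Rightarrow> real) \<Rightarrow> (real^'d \<Rightarrow> real^'s)
      \<Rightarrow> (real^'k \<Rightarrow> real^'s) \<Rightarrow> (real^'k \<Rightarrow> real^'d \<Rightarrow> real) \<Rightarrow> bool" where
  "E_family K S \<Theta> \<alpha> h f w p \<longleftrightarrow> parametric_densities K S \<Theta> w p \<and>
     (\<exists>Z :: real^'k \<Rightarrow> real. (\<forall>\<theta>\<in>\<Theta>. Z differentiable (at \<theta>)) \<and>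
       (\<forall>\<theta>\<in>\<Theta>. \<forall>x\<in>S. power_defined (h x + w \<theta> \<bullet> f x) (1 / (1 - \<alpha>)) \<and>
          p \<theta> x = Z \<theta> * (h x + w \<theta> \<bullet> f x) powr (1 / (1 - \<alpha>))))"

text \<open>
  Regularity. That \<open>S\<close> does not depend on the parameter is built in, since \<open>S\<close> is a single set.
  Note that linear independence of \<open>1, w\<^sub>1, \<dots>, w\<^sub>s\<close> as functions on \<open>\<Theta>\<close> does not imply that
  the Jacobian matrix of \<open>w\<close> is invertible at every (or any) point of \<open>\<Theta>\<close>; for instance it vanishes
  for \<open>w(\<theta>) = \<theta>\<^sup>3\<close> at \<open>0\<close>.
\<close>

definition regular_B_family ::
    "kind \<Rightarrow> (real^'d) set \<Rightarrow> (real^'k) set \<Rightarrow> real \<Rightarrow> (real^'d \<Rightarrow> real) \<Rightarrow> (real^'d \<Rightarrow> real^'s)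
      \<Rightarrow> (real^'k \<Rightarrow> real^'s) \<Rightarrow> (real^'k \<Rightarrow> real^'d \<Rightarrow> real) \<Rightarrow> bool" where
  "regular_B_family K S \<Theta> \<alpha> h f w p \<longleftrightarrow> B_family K S \<Theta> \<alpha> h f w p \<and>
     CARD('s) = CARD('k) \<and> lin_indep_with_1_on \<Theta> w \<and> lin_indep_with_1_on S f"

definition regular_M_family ::
    "kind \<Rightarrow> (real^'d) set \<Rightarrow> (real^'k) set \<Rightarrow> real \<Rightarrow> (real^'d \<Rightarrow> real) \<Rightarrow> (real^'d \<Rightarrow> real^'s)
      \<Rightarrow> (real^'k \<Rightarrow> real^'s) \<Rightarrow> (real^'k \<Rightarrow> real^'d \<Rightarrow> real) \<Rightarrow> bool" where
  "regular_M_family K S \<Theta> \<alpha> h f w p \<longleftrightarrow> M_family K S \<Theta> \<alpha> h f w p \<and>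
     CARD('s) = CARD('k) \<and> lin_indep_with_1_on \<Theta> w \<and> lin_indep_on S f"

definition regular_E_family ::
    "kind \<Rightarrow> (real^'d) set \<Rightarrow> (real^'k) set \<Rightarrow> real \<Rightarrow> (real^'d \<Rightarrow> real) \<Rightarrow> (real^'d \<Rightarrow> real^'s)
      \<Rightarrow> (real^'k \<Rightarrow> real^'s) \<Rightarrow> (real^'k \<Rightarrow> real^'d \<Rightarrow> real) \<Rightarrow> bool" where
  "regular_E_family K S \<Theta> \<alpha> h f w p \<longleftrightarrow> E_family K S \<Theta> \<alpha> h f w p \<and>
     CARD('s) = CARD('k) \<and> lin_indep_with_1_on \<Theta> w \<and> lin_indep_on S f"

definition partial :: "'k \<Rightarrow> (real^'k \<Rightarrow> real^'s) \<Rightarrow> real^'k \<Rightarrow> real^'s" where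
  "partial r w \<theta> = column r (jacobian w (at \<theta>))"

end

theory Submission
  imports Defs
begin

text \<open>
  If the Jacobian of \<open>w\<close> is invertible at \<open>\<theta>\<close>, the partial derivatives of \<open>w\<close> span the whole space,
  so a vector is determined by its inner products with them. This is (a). For (b) and (c), linearity
  of the expectation turns the denominators into \<open>a + w \<bullet> u\<close> and \<open>b + w \<bullet> v\<close>, with \<open>a, b\<close> the means of
  \<open>h\<close> and \<open>u, v\<close> those of \<open>f\<close>, and the map \<open>y \<mapsto> y / (1 + w \<bullet> y)\<close> sends \<open>u / a\<close> to \<open>u / (a + w \<bullet> u)\<close>
  and has the inverse \<open>z \<mapsto> z / (1 - w \<bullet> z)\<close>.
\<close>

text \<open>The difference \<open>u - v\<close> is orthogonal to every column, but since
  \<open>A\<close> is surjective it is also a combination of columns, so it is orthogonal to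
  itself.\<close>

lemma eq_if_inner_columns_eq:
  fixes A :: "real^'k^'s"
  assumes "invertible A" and "\<And>r. column r A \<bullet> u = column r A \<bullet> v"
  shows "u = v"
proof -
  obtain B where AB: "A ** B = mat 1"
    using assms(1) by (auto simp: invertible_def)
  define d where "d = u - v"
  have 0: "column r A \<bullet> d = 0" for r
    using assms(2)[of r] by (simp add: d_def inner_diff_right)
  have "d = A *v (B *v d)"
    by (simp add: matrix_vector_mul_assoc AB)
  also have "\<dots> = (\<Sum>r\<in>UNIV. (B *v d) $ r *\<^sub>R column r A)"
    by (simp add: matrix_mult_sum scalar_mult_eq_scaleR)
  finally have "d \<bullet> d = (\<Sum>r\<in>UNIV. (B *v d) $ r *\<^sub>R column r A) \<bullet> d"
    by simp
  also have "\<dots> = 0"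
    by (simp add: inner_sum_left 0)
  finally show ?thesis
    by (simp add: d_def)
qed

lemma scaled_eq_iff_affine_scaled_eq:
  fixes u v w :: "'a::real_inner" and a b :: real
  assumes "a \<noteq> 0" "b \<noteq> 0" "a + w \<bullet> u \<noteq> 0" "b + w \<bullet> v \<noteq> 0"
  shows "u /\<^sub>R (a + w \<bullet> u) = v /\<^sub>R (b + w \<bullet> v) \<longleftrightarrow> u /\<^sub>R a = v /\<^sub>R b"
proof
  have denom: "1 + w \<bullet> (x /\<^sub>R c) = (c + w \<bullet> x) / c" if "c \<noteq> 0" for x c
    using that by (simp add: field_simps)
  \<comment> \<open>If \<open>c + w \<bullet> x = 0\<close>, both sides vanish because
    \<open>inverse 0 = 0\<close>, so the identity covers that case as well.\<close>
  have fwd: "x /\<^sub>R (c + w \<bullet> x) = (x /\<^sub>R c) /\<^sub>R (1 + w \<bullet> (x /\<^sub>R c))" if "c \<noteq> 0" for x c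
    using that by (simp only: denom[OF that]) (simp add: field_simps)
  show "u /\<^sub>R (a + w \<bullet> u) = v /\<^sub>R (b + w \<bullet> v)" if "u /\<^sub>R a = v /\<^sub>R b"
    unfolding fwd[OF assms(1)] fwd[OF assms(2)] that ..
next
  have denom: "1 - w \<bullet> (x /\<^sub>R (c + w \<bullet> x)) = c / (c + w \<bullet> x)" if "c + w \<bullet> x \<noteq> 0" for x c
    using that by (simp add: field_simps)
  have bwd: "x /\<^sub>R c = (x /\<^sub>R (c + w \<bullet> x)) /\<^sub>R (1 - w \<bullet> (x /\<^sub>R (c + w \<bullet> x)))"
    if "c + w \<bullet> x \<noteq> 0" for x c
    using that by (simp only: denom[OF that]) (simp add: field_simps)
  show "u /\<^sub>R a = v /\<^sub>R b" if "u /\<^sub>R (a + w \<bullet> u) = v /\<^sub>R (b + w \<bullet> v)"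
    using bwd[OF assms(3)] bwd[OF assms(4)] that by metis
qed

text \<open>Nonintegrable functions have integral 0 by convention, so the integral is split using
  that both expectations exist.\<close>

lemma expect_add_inner:
  fixes f :: "'x \<Rightarrow> 'b::euclidean_space"
  assumes "has_expectation M q f" "has_expectation M q h"
  shows "expect M q (\<lambda>x. h x + c \<bullet> f x) = expect M q h + c \<bullet> expect M q f"
proof -
  have f: "integrable M (\<lambda>x. q x *\<^sub>R f x)" and h: "integrable M (\<lambda>x. q x * h x)"
    using assms by (simp_all add: has_expectation_def)
  have "(\<integral>x. q x * h x + c \<bullet> (q x *\<^sub>R f x) \<partial>M)
      = (\<integral>x. q x * h x \<partial>M) + c \<bullet> (\<integral>x. q x *\<^sub>R f x \<partial>M)"
    \<comment> \<open>The scalar \<open>q x\<close> has to stay inside the inner product, so that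
      \<open>c \<bullet> _\<close> can be pulled out of the integral of
      \<open>q x *\<^sub>R f x\<close>.\<close>
    using f h by (simp del: inner_scaleR_right)
  then show ?thesis
    by (simp add: expect_def distrib_left)
qed

lemma partial_system_iff:
  assumes "invertible (jacobian w (at \<theta>))"
  shows "(\<forall>r. partial r w \<theta> \<bullet> u = partial r w \<theta> \<bullet> v) \<longleftrightarrow> u = v"
  using eq_if_inner_columns_eq[OF assms, of u v] by (auto simp: partial_def)

text \<open>Stated for arbitrary \<open>a\<close>, \<open>b\<close>, \<open>u\<close>,
  \<open>v\<close>, so that it serves both (b) and (c).\<close>

lemma partial_quotient_system:
  fixes w :: "real^'k \<Rightarrow> real^'s" and u v :: "real^'s"
  assumes nz: "a \<noteq> 0" "b \<noteq> 0" "a + w \<theta> \<bullet> u \<noteq> 0" "b + w \<theta> \<bullet> v \<noteq> 0"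
  defines "Sys \<equiv> \<forall>r. (partial r w \<theta> \<bullet> u) / (a + w \<theta> \<bullet> u)
                        = (partial r w \<theta> \<bullet> v) / (b + w \<theta> \<bullet> v)"
    and "Red \<equiv> (u /\<^sub>R a = v /\<^sub>R b)"
  shows "(Red \<longrightarrow> Sys) \<and> (invertible (jacobian w (at \<theta>)) \<longrightarrow> (Sys \<longleftrightarrow> Red))"
proof -
  \<comment> \<open>Each denominator is independent of \<open>r\<close> and moves into the inner
    product, which gives a system as in (a) for rescaled vectors.\<close>
  have sys: "Sys \<longleftrightarrow> (\<forall>r. partial r w \<theta> \<bullet> (u /\<^sub>R (a + w \<theta> \<bullet> u))
                              = partial r w \<theta> \<bullet> (v /\<^sub>R (b + w \<theta> \<bullet> v)))"
    by (simp add: Sys_def divide_inverse mult.commute)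
  have red: "Red \<longleftrightarrow> u /\<^sub>R (a + w \<theta> \<bullet> u) = v /\<^sub>R (b + w \<theta> \<bullet> v)"
    unfolding Red_def scaled_eq_iff_affine_scaled_eq[OF nz] ..
  show ?thesis
    unfolding sys red using partial_system_iff[of w \<theta>] by metis
qed

text \<open>Where all partial derivatives of \<open>w\<close> vanish, the system holds trivially and
  says nothing about the means. The equivalence is therefore claimed at points with invertible
  Jacobian, and \<open>reduced \<longrightarrow> system\<close> everywhere.\<close>

theorem corollary11:
  fixes \<alpha> :: real and n :: nat and X :: "nat \<Rightarrow> real^'d" and K :: kind
    and S :: "(real^'d) set" and \<Theta> :: "(real^'k) set"
    and h :: "real^'d \<Rightarrow> real" and f :: "real^'d \<Rightarrow> real^'s" and w :: "real^'k \<Rightarrow> real^'s"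
    and p :: "real^'k \<Rightarrow> real^'d \<Rightarrow> real" and q :: "real^'d \<Rightarrow> real"
    and \<mu> :: "(real^'d) measure"
  defines "\<mu> \<equiv> base_measure K S"
  assumes "0 < \<alpha>" and "\<alpha> \<noteq> 1" and "1 \<le> n"
  shows
    "(regular_B_family K S \<Theta> \<alpha> h f w p \<longrightarrow>
       (\<forall>\<theta>\<in>\<Theta>. has_expectation \<mu> (p \<theta>) f \<longrightarrow>
          (let system = (\<forall>r. partial r w \<theta> \<bullet> expect \<mu> (p \<theta>) f
                             = partial r w \<theta> \<bullet> sample_mean n X f);
               reduced = (expect \<mu> (p \<theta>) f = sample_mean n X f)
           in (reduced \<longrightarrow> system) \<and>
              (invertible (jacobian w (at \<theta>)) \<longrightarrow> (system \<longleftrightarrow> reduced)))))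
     \<and>
     (regular_M_family K S \<Theta> \<alpha> h f w p \<longrightarrow>
       (\<forall>\<theta>\<in>\<Theta>. has_expectation \<mu> (p \<theta>) f \<and> has_expectation \<mu> (p \<theta>) h \<and>
          expect \<mu> (p \<theta>) h \<noteq> 0 \<and> expect \<mu> (p \<theta>) (\<lambda>x. h x + w \<theta> \<bullet> f x) \<noteq> 0 \<and>
          sample_mean n X h \<noteq> 0 \<and> sample_mean n X h + w \<theta> \<bullet> sample_mean n X f \<noteq> 0 \<longrightarrow>
          (let system = (\<forall>r. (partial r w \<theta> \<bullet> expect \<mu> (p \<theta>) f)
                               / expect \<mu> (p \<theta>) (\<lambda>x. h x + w \<theta> \<bullet> f x)
                             = (partial r w \<theta> \<bullet> sample_mean n X f)
                               / (sample_mean n X h + w \<theta> \<bullet> sample_mean n X f));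
               reduced = (expect \<mu> (p \<theta>) f /\<^sub>R expect \<mu> (p \<theta>) h
                          = sample_mean n X f /\<^sub>R sample_mean n X h)
           in (reduced \<longrightarrow> system) \<and>
              (invertible (jacobian w (at \<theta>)) \<longrightarrow> (system \<longleftrightarrow> reduced)))))
     \<and>
     (regular_E_family K S \<Theta> \<alpha> h f w p \<and> sample_estimate K S n X q \<and> has_escort \<mu> \<alpha> q \<longrightarrow>
       (let q\<alpha> = escort \<mu> \<alpha> q; h_bar = expect \<mu> q\<alpha> h; f_bar = expect \<mu> q\<alpha> f
        in has_expectation \<mu> q\<alpha> h \<and> has_expectation \<mu> q\<alpha> f \<longrightarrow>
           (\<forall>\<theta>\<in>\<Theta>. let p\<alpha> = escort \<mu> \<alpha> (p \<theta>) in
              has_escort \<mu> \<alpha> (p \<theta>) \<and> has_expectation \<mu> p\<alpha> f \<and> has_expectation \<mu> p\<alpha> h \<and>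
              expect \<mu> p\<alpha> h \<noteq> 0 \<and> expect \<mu> p\<alpha> (\<lambda>x. h x + w \<theta> \<bullet> f x) \<noteq> 0 \<and>
              h_bar \<noteq> 0 \<and> h_bar + w \<theta> \<bullet> f_bar \<noteq> 0 \<longrightarrow>
              (let system = (\<forall>r. (partial r w \<theta> \<bullet> expect \<mu> p\<alpha> f)
                                   / expect \<mu> p\<alpha> (\<lambda>x. h x + w \<theta> \<bullet> f x)
                                 = (partial r w \<theta> \<bullet> f_bar) / (h_bar + w \<theta> \<bullet> f_bar));
                   reduced = (expect \<mu> p\<alpha> f /\<^sub>R expect \<mu> p\<alpha> h = f_bar /\<^sub>R h_bar)
               in (reduced \<longrightarrow> system) \<and>
                  (invertible (jacobian w (at \<theta>)) \<longrightarrow> (system \<longleftrightarrow> reduced))))))"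
proof (intro conjI, goal_cases)
  case 1
  show ?case
    unfolding Let_def using partial_system_iff[of w] by metis
next
  case 2
  show ?case
    unfolding Let_def
  proof (intro impI ballI, elim conjE, goal_cases)
    case (1 \<theta>)
    \<comment> \<open>Linearity rewrites the denominator both in the system and in the premise that
      it is nonzero.\<close>
    from 1 show ?case
      by (simp only: expect_add_inner) (intro partial_quotient_system)
  qed
next
  case 3
  show ?case
    unfolding Let_def
  proof (intro impI ballI, elim conjE, goal_cases)
    case (1 \<theta>)
    \<comment> \<open>As in (b), with the escort of \<open>q\<close> supplying \<open>b\<close> and
      \<open>v\<close> in place of the sample means.\<close>
    from 1 show ?case
      by (simp only: expect_add_inner) (intro partial_quotient_system)
  qed
qed

end
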